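(* Let $\mathbb{K}$ be a commutative ring, let $n\in\mathbb{N}$, and let $k\in\{0,1,\ldots,n\}$. Let $A=(a_{i,j})_{1\leq i\leq n+1,\ 1\leq j\leq n+1}\in\mathbb{K}^{(n+1)\times(n+1)}$ and $B=(b_{i,j})_{1\leq i\leq n+1,\ 1\leq j\leq n+1}\in\mathbb{K}^{(n+1)\times(n+1)}$ be two matrices such that $a_{n+1,n+1}=0$ and $b_{n+1,n+1}=0$. Let $W$ be the $P_k\times P_k$-matrix whose $(I,J)$-th entry (for all $I\in P_k$ and $J\in P_k$) is \[ \det\left(\operatorname{sub}_{I+}^{J+}A\right)\det\left(\operatorname{sub}_{I+}^{J+}B\right). \] Then $(\det A)(\det B)\mid\det W$ in $\mathbb{K}$.
   Context: $\mathbb{N}=\{0,1,2,\ldots\}$, and $[m]=\{1,2,\ldots,m\}$ for $m\in\mathbb{N}$. For elements $a,b$ of a commutative ring $\mathbb{K}$, $a\mid b$ means $b\in\mathbb{K}a$. $P_k$ denotes the set of all $k$-element subsets of $[n]$. For a subset $K\subseteq[n]$, $K+$ denotes the subset $K\cup\{n+1\}$ of $[n+1]$. For a $u\times v$-matrix $A=(a_{i,j})$ and subsets $I=\{i_1<i_2<\cdots<i_p\}\subseteq[u]$ and $J=\{j_1<j_2<\cdots<j_q\}\subseteq[v]$, $\operatorname{sub}_I^J A$ denotes the $p\times q$ submatrix $(a_{i_x,j_y})_{1\leq x\leq p,\ 1\leq y\leq q}$ (rows indexed by $I$, columns indexed by $J$). A $P_k\times P_k$-matrix is a matrix whose rows and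 columns are indexed by the elements of the finite set $P_k$; its determinant is well-defined (choose any total order on $P_k$ and use it for both rows and columns). *)

theory Defs
  imports
    "Jordan_Normal_Form.Determinant"
    "Jordan_Normal_Form.DL_Submatrix"
begin

text \<open>
  Matrix indices start at 0, as usual for the type \<open>mat\<close>: \<open>[n]\<close> is rendered as \<open>{..<n}\<close>,
  and the last index \<open>n + 1\<close> of an \<open>(n + 1) \<times> (n + 1)\<close>-matrix is rendered as \<open>n\<close>.
\<close>

definition ksubsets :: "nat \<Rightarrow> nat \<Rightarrow> nat set set" where
  "ksubsets n k = {I. I \<subseteq> {..<n} \<and> card I = k}"

definition plus_last :: "nat \<Rightarrow> nat set \<Rightarrow> nat set" where
  "plus_last n I = insert n I"

text \<open>
  A matrix indexed by a finite set \<open>S\<close> is a function \<open>W\<close> on \<open>S \<times> S\<close>. An enumeration of \<open>S\<close>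
  by a distinct list \<open>xs\<close> (that is, a total order on \<open>S\<close>), used for both rows and columns,
  turns it into an ordinary square matrix; its determinant does not depend on \<open>xs\<close>.
\<close>

definition mat_of_enum :: "'i list \<Rightarrow> ('i \<Rightarrow> 'i \<Rightarrow> 'a) \<Rightarrow> 'a mat" where
  "mat_of_enum xs W = mat (length xs) (length xs) (\<lambda>(p, q). W (xs ! p) (xs ! q))"

end

theory Submission
  imports Defs
begin

text \<open>
  Number rows and columns \<open>0, \<dots>, n\<close> and write \<open>I+ = I \<union> {n}\<close>, \<open>W\<close> for the matrix of products of
  minors, \<open>b\<^sub>j = B\<^sub>n\<^sub>j\<close> for the last row of \<open>B\<close> and \<open>v\<^sub>j\<close> for the cofactor of \<open>A\<close> at \<open>(n, j)\<close>, so
  that \<open>A v = det A \<cdot> e\<^sub>n\<close>.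

  The heart of the matter is a half of the theorem: if only \<open>B\<^sub>n\<^sub>n = 0\<close> then \<open>det A\<close> divides \<open>det W\<close>
  (\<open>det_dvd_det_minor_products\<close>). The vector \<open>w\<close> with \<open>w\<^sub>J = \<Prod>\<^sub>j\<^sub>\<in>\<^sub>J v\<^sub>j \<cdot> \<Prod>\<^sub>j\<^sub>\<notin>\<^sub>J b\<^sub>j\<close> is a
  kernel vector of \<open>W\<close> modulo \<open>det A\<close>. Indeed, expand the minor of \<open>B\<close> in \<open>W\<^sub>I\<^sub>J\<close> along its last
  row. The summand that belongs to the column \<open>j \<in> J\<close> carries the factor \<open>b\<^sub>j\<close>, and
  \<open>b\<^sub>j w\<^sub>J = v\<^sub>j w\<^sub>Z\<close> for \<open>Z = J - {j}\<close>; as \<open>b\<^sub>n = 0\<close>, the column \<open>n\<close> contributes nothing. Grouping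
  by \<open>Z\<close>, the minors of \<open>A\<close> on the columns \<open>Z+\<close> and \<open>j\<close>, weighted by \<open>v\<^sub>j\<close> and summed over \<open>j\<close>, add
  up to a determinant with last column \<open>A v = det A \<cdot> e\<^sub>n\<close> (\<open>det_dvd_weighted_row_sum\<close>).
  Multiplying \<open>W w\<close> by the adjugate of \<open>W\<close> shows that \<open>det A\<close> divides \<open>w\<^sub>J \<cdot> det W\<close> for each \<open>J\<close>.

  It remains to cancel \<open>w\<^sub>J\<close>. This is legitimate for generic matrices, and two parameters already
  make the matrices generic enough: over \<open>K[x][z]\<close>, replace \<open>A\<close> by \<open>A + z (S + x T)\<close>, where
  \<open>det (S + x T) = x\<^sup>n\<^sup>+\<^sup>1\<close> while all cofactors of the last row of \<open>S\<close> are \<open>\<plusminus>1\<close>, and add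
  \<open>z\<close> to the entries \<open>b\<^sub>j\<close> with \<open>j < n\<close>. In terms of \<open>s = z\<close> and \<open>t = x z\<close> this is a perturbation
  with \<open>s S + t T\<close>, and the leading form of \<open>det A\<close> is a power of \<open>t\<close>, whereas the leading form
  of \<open>w\<^sub>J\<close> contains a power of \<open>s\<close> with unit coefficient. Such leading forms are coprime, whence
  \<open>w\<^sub>J\<close> may be cancelled (\<open>dvd_cancel_coprime_lead\<close>). Finally set \<open>x = z = 0\<close>.

  For the theorem itself, both corners vanish, so \<open>det A\<close> and \<open>det B\<close> both divide \<open>det W\<close>. Perturb
  \<open>B\<close> alone by \<open>z\<close> times a transposition matrix with corner \<open>0\<close>. Then \<open>det B\<close> has a unit leading
  coefficient, while \<open>det A\<close> is a constant polynomial. From \<open>det W = det B \<cdot> c\<close> it follows that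
  \<open>det A\<close> divides \<open>c\<close> (\<open>const_dvd_cancel_unit_lead\<close>), and \<open>z = 0\<close> gives the claim.
\<close>

section \<open>Leading coefficients and cancellation\<close>

lemma coeff_mult_degree_bounds:
  fixes p q :: "'a :: comm_semiring_0 poly"
  assumes "degree p \<le> a" "degree q \<le> b"
  shows "coeff (p * q) (a + b) = coeff p a * coeff q b"
proof -
  have "coeff p i * coeff q (a + b - i) = 0" if "i \<noteq> a" for i
    using that assms by (cases "i < a") (auto simp: coeff_eq_0)
  then have "(\<Sum>i\<le>a + b. coeff p i * coeff q (a + b - i))
      = (\<Sum>i\<in>{a}. coeff p i * coeff q (a + b - i))"
    by (intro sum.mono_neutral_right) auto
  then show ?thesis by (simp add: coeff_mult)
qed

lemma degree_coeff_prod_bounds: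
  fixes f :: "'i \<Rightarrow> 'a :: comm_semiring_1 poly"
  assumes "finite S" "\<And>i. i \<in> S \<Longrightarrow> degree (f i) \<le> d i"
  shows "degree (prod f S) \<le> sum d S \<and> coeff (prod f S) (sum d S) = (\<Prod>i\<in>S. coeff (f i) (d i))"
  using assms
proof (induction S rule: finite_induct)
  case (insert i S)
  then have *: "degree (f i) \<le> d i" "degree (prod f S) \<le> sum d S"
    "coeff (prod f S) (sum d S) = (\<Prod>i\<in>S. coeff (f i) (d i))" by auto
  have "degree (f i * prod f S) \<le> d i + sum d S"
    using degree_mult_le[of "f i" "prod f S"] * by linarith
  with insert.hyps * show ?case by (simp add: coeff_mult_degree_bounds)
qed simp

lemma degree_less_if_lead_cancelled:
  fixes p :: "'a :: zero poly"
  assumes "degree p \<le> d" "coeff p d = 0"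
  shows "p = 0 \<or> degree p < d"
  using assms by (metis le_neq_implies_less leading_coeff_0_iff)

text \<open>
  Since the top coefficient of \<open>g\<close> is a unit, \<open>q\<close> divides the leading coefficient of \<open>c\<close>;
  subtract the leading term and repeat.
\<close>
lemma const_dvd_cancel_unit_lead:
  fixes g c :: "'a :: comm_ring_1 poly"
  assumes "degree g \<le> b" "coeff g b dvd 1" "[:q:] dvd g * c"
  shows "[:q:] dvd c"
  using assms(3)
proof (induction "degree c" arbitrary: c rule: less_induct)
  case less
  let ?d = "degree c"
  have "q dvd coeff (g * c) (b + ?d)"
    using less.prems by (auto elim!: dvdE)
  then have "q dvd coeff g b * lead_coeff c"
    using assms(1) by (simp add: coeff_mult_degree_bounds)
  moreover obtain u where "1 = coeff g b * u" using assms(2) by (auto elim: dvdE)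
  ultimately have "q dvd lead_coeff c"
    by (metis dvd_mult2 mult.assoc mult.commute mult_1)
  then obtain r where "lead_coeff c = q * r" by (elim dvdE)
  then have "monom (lead_coeff c) ?d = [:q:] * monom r ?d" by (simp add: smult_monom)
  then have top: "[:q:] dvd monom (lead_coeff c) ?d" by (metis dvd_triv_left)
  define c' where "c' = c - monom (lead_coeff c) ?d"
  have "[:q:] dvd g * c'"
    unfolding c'_def right_diff_distrib by (rule dvd_diff[OF less.prems dvd_mult[OF top]])
  moreover have "c' = 0 \<or> degree c' < ?d"
    by (rule degree_less_if_lead_cancelled) (auto simp: c'_def intro: degree_diff_le degree_monom_le)
  ultimately have "[:q:] dvd c'" using less.hyps by auto
  then have "[:q:] dvd c' + monom (lead_coeff c) ?d" using top by (rule dvd_add)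
  then show ?case by (simp add: c'_def)
qed

text \<open>
  View \<open>K[x][z]\<close> with inner variable \<open>x\<close> and outer variable \<open>z\<close>. The dominated polynomials are those
  in \<open>K[s, t]\<close>, embedded by \<open>s = z\<close>, \<open>t = x z\<close>: the homogeneous component of degree \<open>d\<close> becomes the
  coefficient of \<open>z\<^sup>d\<close>, dehomogenised to a polynomial in \<open>x\<close> of degree at most \<open>d\<close>.
\<close>
definition dominated :: "'a :: comm_ring_1 poly poly \<Rightarrow> bool" where
  "dominated p \<longleftrightarrow> (\<forall>d. degree (coeff p d) \<le> d)"

lemma dominated_ring_operations:
  "dominated 0" "dominated 1"
  "dominated p \<Longrightarrow> dominated (- p)"
  "dominated p \<Longrightarrow> dominated q \<Longrightarrow> dominated (p + q)"
  "dominated p \<Longrightarrow> dominated q \<Longrightarrow> dominated (p - q)"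
  "degree a \<le> d \<Longrightarrow> dominated (monom a d)"
  by (auto simp: dominated_def degree_add_le degree_diff_le)

lemma dominated_pencil: "degree b \<le> 1 \<Longrightarrow> dominated [:[:a:], b:]"
  by (auto simp: dominated_def coeff_pCons split: nat.split)

lemma dominated_mult:
  fixes p q :: "'a :: comm_ring_1 poly poly"
  assumes "dominated p" "dominated q"
  shows "dominated (p * q)"
  unfolding dominated_def coeff_mult
proof (intro allI degree_sum_le)
  fix d i :: nat assume "i \<in> {..d}"
  moreover have "degree (coeff p i * coeff q (d - i)) \<le> degree (coeff p i) + degree (coeff q (d - i))"
    by (rule degree_mult_le)
  moreover have "degree (coeff p i) \<le> i" "degree (coeff q (d - i)) \<le> d - i"
    using assms by (auto simp: dominated_def)
  ultimately show "degree (coeff p i * coeff q (d - i)) \<le> d" by simp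
qed simp

lemma dominated_sum: "(\<And>i. i \<in> S \<Longrightarrow> dominated (f i)) \<Longrightarrow> dominated (sum f S)"
  by (induction S rule: infinite_finite_induct) (auto intro: dominated_ring_operations)

lemma dominated_prod: "(\<And>i. i \<in> S \<Longrightarrow> dominated (f i)) \<Longrightarrow> dominated (prod f S)"
  by (induction S rule: infinite_finite_induct) (auto intro: dominated_ring_operations dominated_mult)

lemma dominated_det:
  assumes A: "A \<in> carrier_mat m m"
    and entries: "\<And>i j. i < m \<Longrightarrow> j < m \<Longrightarrow> dominated (A $$ (i, j))"
  shows "dominated (det A)"
  unfolding det_def'[OF A]
proof (intro dominated_sum dominated_mult)
  fix p assume "p \<in> {p. p permutes {0..<m}}"
  then show "dominated (\<Prod>i = 0..<m. A $$ (i, p i))"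
    by (intro dominated_prod entries) (auto dest: permutes_in_image[of p _ ])
  show "dominated (signof p)" by (auto simp: sign_def intro: dominated_ring_operations)
qed

text \<open>
  In the coordinates \<open>s = z\<close>, \<open>t = x z\<close> the form of degree \<open>b\<close> contains \<open>s\<^sup>b\<close> with a unit
  coefficient. This makes it coprime to every power of \<open>t\<close>.
\<close>
definition coprime_lead :: "'a :: comm_ring_1 poly poly \<Rightarrow> bool" where
  "coprime_lead g \<longleftrightarrow> (\<exists>b. degree g \<le> b \<and> coeff (coeff g b) 0 dvd 1)"

lemma coprime_lead_1: "coprime_lead 1"
  by (auto simp: coprime_lead_def intro!: exI[of _ 0])

lemma coprime_lead_mult:
  assumes "coprime_lead p" "coprime_lead q"
  shows "coprime_lead (p * q)"
proof -
  obtain a b where ab: "degree p \<le> a" "coeff (coeff p a) 0 dvd 1" "degree q \<le> b" "coeff (coeff q b) 0 dvd 1"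
    using assms by (auto simp: coprime_lead_def)
  have "degree (p * q) \<le> a + b" using degree_mult_le[of p q] ab by linarith
  moreover have "coeff (coeff (p * q) (a + b)) 0 dvd 1"
    using ab mult_dvd_mono[OF ab(2,4)] by (simp add: coeff_mult_degree_bounds coeff_mult_0)
  ultimately show ?thesis by (auto simp: coprime_lead_def)
qed

lemma coprime_lead_prod: "(\<And>i. i \<in> S \<Longrightarrow> coprime_lead (f i)) \<Longrightarrow> coprime_lead (prod f S)"
  by (induction S rule: infinite_finite_induct)
    (auto intro: coprime_lead_mult simp: coprime_lead_1)

text \<open>
  Induction on the degree \<open>d\<close> of \<open>h\<close> in \<open>z\<close>. Let \<open>H\<close> be the leading coefficient of \<open>h\<close>.
  Comparing top coefficients in \<open>g h = f c\<close> shows that \<open>x\<^sup>m\<close> divides \<open>G H\<close> for the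
  coefficient \<open>G\<close> of \<open>z\<^sup>b\<close> in \<open>g\<close>. As \<open>G(0)\<close> is a unit, this gives
  \<open>H = x\<^sup>m H'\<close>, and \<open>f z\<^sup>d\<^sup>-\<^sup>m H'\<close> can be subtracted from \<open>h\<close>. The exponent \<open>d - m\<close> makes
  sense because \<open>h\<close> is dominated: \<open>m \<le> deg H \<le> d\<close>. Without that hypothesis the lemma fails, as
  \<open>f = x z\<close>, \<open>g = z\<close>, \<open>h = x\<close> shows.
\<close>
lemma dvd_cancel_coprime_lead:
  fixes f g h :: "'a :: comm_ring_1 poly poly"
  assumes f: "degree f \<le> m" "coeff f m = monom 1 m" "dominated f"
    and "coprime_lead g"
    and h: "dominated h" "f dvd g * h"
  shows "f dvd h"
proof -
  obtain b where g: "degree g \<le> b" "coeff (coeff g b) 0 dvd 1"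
    using \<open>coprime_lead g\<close> by (auto simp: coprime_lead_def)
  show ?thesis
    using h
  proof (induction "degree h" arbitrary: h rule: less_induct)
    case less
    define d where "d = degree h"
    define H where "H = lead_coeff h"
    obtain c where c: "g * h = f * c" using less.prems(2) by (elim dvdE)
    have "coeff (f * c) (b + d) = coeff g b * H"
      unfolding c[symmetric] H_def d_def using g(1) by (simp add: coeff_mult_degree_bounds)
    moreover have "monom 1 m dvd coeff (f * c) (b + d)"
    proof -
      have "coeff (f * c) (m + degree c) = monom 1 m * lead_coeff c"
        using f by (simp add: coeff_mult_degree_bounds)
      moreover have "degree (f * c) \<le> m + degree c"
        using degree_mult_le[of f c] f(1) by linarith
      moreover have "m + degree c \<le> b + d" if "c \<noteq> 0"
      proof -
        have "coeff (monom 1 m * lead_coeff c) (m + degree (lead_coeff c)) \<noteq> 0"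
          using that by (simp add: coeff_monom_mult)
        with calculation have "m + degree c \<le> degree (g * h)"
          unfolding c by (metis coeff_0 le_degree)
        then show ?thesis
          unfolding d_def using degree_mult_le[of g h] g(1) by linarith
      qed
      ultimately show ?thesis
        by (cases "c = 0"; cases "m + degree c = b + d") (fastforce simp: coeff_eq_0)+
    qed
    ultimately have low: "coeff (coeff g b * H) k = 0" if "k < m" for k
      using that by (simp add: monom_1_dvd_iff')
    \<comment> \<open>The lowest coefficients of \<open>H\<close> vanish one after the other because \<open>G(0)\<close> is a unit.\<close>
    have "coeff H k = 0" if "k < m" for k
      using that
    proof (induction k rule: less_induct)
      case (less k)
      have "coeff (coeff g b * H) k = (\<Sum>i\<in>{0}. coeff (coeff g b) i * coeff H (k - i))"
        unfolding coeff_mult using less by (intro sum.mono_neutral_right) auto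
      then have "coeff (coeff g b) 0 * coeff H k = 0" using low less.prems by simp
      moreover obtain u where "1 = coeff (coeff g b) 0 * u" using g(2) by (elim dvdE)
      ultimately show ?case by (metis mult.assoc mult.commute mult_1 mult_zero_left)
    qed
    then obtain H' where H': "H = monom 1 m * H'" by (metis monom_1_dvd_iff' dvdE)
    have coeff_H': "coeff H' k = coeff H (m + k)" for k by (simp add: H' coeff_monom_mult)
    have H_deg: "degree H \<le> d" using less.prems(1) by (simp add: dominated_def H_def d_def)
    show ?case
    proof (cases "h = 0")
      case False
      then have "H \<noteq> 0" by (simp add: H_def)
      then have "m \<le> d"
        using H_deg \<open>\<And>k. k < m \<Longrightarrow> coeff H k = 0\<close> by (metis le_less_trans leading_coeff_0_iff not_le)
      have "degree H' \<le> d - m"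
        by (rule degree_le) (use H_deg in \<open>auto simp: coeff_H' intro!: coeff_eq_0\<close>)
      define h' where "h' = h - f * monom H' (d - m)"
      have "dominated h'"
        unfolding h'_def using less.prems(1) f(3) \<open>degree H' \<le> d - m\<close>
        by (intro dominated_ring_operations dominated_mult)
      moreover have "g * h' = f * (c - g * monom H' (d - m))"
        by (simp add: h'_def algebra_simps c)
      moreover have "h' = 0 \<or> degree h' < d"
      proof (rule degree_less_if_lead_cancelled)
        have m: "degree (monom H' (d - m)) \<le> d - m" by (rule degree_monom_le)
        have "degree (f * monom H' (d - m)) \<le> d"
          using degree_mult_le[of f "monom H' (d - m)"] f(1) m \<open>m \<le> d\<close> by linarith
        then show "degree h' \<le> d" by (simp add: h'_def d_def degree_diff_le)
        show "coeff h' d = 0"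
          using coeff_mult_degree_bounds[OF f(1) m] \<open>m \<le> d\<close> H'
          by (simp add: h'_def f(2) H_def d_def)
      qed
      ultimately have "f dvd h'" using less.hyps d_def by fastforce
      then have "f dvd h' + f * monom H' (d - m)" by simp
      then show ?thesis by (simp add: h'_def)
    qed simp
  qed
qed

section \<open>Determinants of linear matrix pencils\<close>

lemma det_pencil_top:
  fixes P :: "'a :: comm_ring_1 poly mat"
  assumes P: "P \<in> carrier_mat m m"
    and deg: "\<And>i j. i < m \<Longrightarrow> j < m \<Longrightarrow> degree (P $$ (i, j)) \<le> 1"
  shows "degree (det P) \<le> m" "coeff (det P) m = det (map_mat (\<lambda>p. coeff p 1) P)"
proof -
  show "degree (det P) \<le> m" using degree_det_le[OF deg P] by simp
  have "coeff (det P) m = (\<Sum>p\<in>{p. p permutes {0..<m}}.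
      signof p * (\<Prod>i = 0..<m. coeff (P $$ (i, p i)) 1))"
    unfolding det_def'[OF P] coeff_sum
  proof (rule sum.cong[OF refl])
    fix p assume "p \<in> {p. p permutes {0..<m}}"
    then have "coeff (\<Prod>i = 0..<m. P $$ (i, p i)) (\<Sum>i = 0..<m. 1)
        = (\<Prod>i = 0..<m. coeff (P $$ (i, p i)) 1)"
      by (intro degree_coeff_prod_bounds[THEN conjunct2] deg) (auto dest: permutes_in_image[of p _])
    then show "coeff (signof p * (\<Prod>i = 0..<m. P $$ (i, p i))) m
        = signof p * (\<Prod>i = 0..<m. coeff (P $$ (i, p i)) 1)"
      by (simp add: sign_def)
  qed
  also have "\<dots> = det (map_mat (\<lambda>p. coeff p 1) P)"
    by (subst det_def'[of _ m]) (use P in \<open>auto intro!: sum.cong prod.cong dest: permutes_in_image[of _ "{0..<m}"]\<close>)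
  finally show "coeff (det P) m = det (map_mat (\<lambda>p. coeff p 1) P)" .
qed

text \<open>
  The pencil is \<open>(N + x) U\<close> with \<open>N\<close> the nilpotent shift and \<open>U\<close> unimodular; \<open>U\<close> maps the
  all-ones vector to the first unit vector, which spans the kernel of \<open>N\<close>. So at \<open>x = 0\<close> the
  kernel is spanned by the all-ones vector, although the determinant is a power of \<open>x\<close>.
\<close>
definition unit_pencil :: "nat \<Rightarrow> 'a :: comm_ring_1 poly mat" where
  "unit_pencil m = mat m m (\<lambda>(i, j). if j = i then [:0, 1:] else if j = Suc i then 1 else 0)
     * mat m m (\<lambda>(i, j). if i = j then 1 else if j = 0 then - 1 else 0)"

lemma unit_pencil_carrier: "unit_pencil m \<in> carrier_mat m m"
  unfolding unit_pencil_def by (intro mult_carrier_mat) auto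

lemma unit_pencil_index:
  assumes "i < m" "j < m"
  shows "unit_pencil m $$ (i, j) =
    [:0, 1:] * (if i = j then 1 else if j = 0 then - 1 else 0)
    + (if Suc i < m then (if Suc i = j then 1 else if j = 0 then - 1 else 0) else 0)"
proof -
  let ?N = "\<lambda>i j. if j = i then [:0, 1:] else if j = Suc i then 1 else (0 :: 'a poly)"
  let ?U = "\<lambda>i j. if i = j then 1 else if j = 0 then - 1 else (0 :: 'a poly)"
  have "unit_pencil m $$ (i, j) = (\<Sum>l = 0..<m. ?N i l * ?U l j)"
    using assms by (auto simp: unit_pencil_def scalar_prod_def intro!: sum.cong)
  also have "\<dots> = (\<Sum>l \<in> {i} \<union> (if Suc i < m then {Suc i} else {}). ?N i l * ?U l j)"
    using assms by (intro sum.mono_neutral_right) auto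
  finally show ?thesis by simp
qed

lemma det_unit_pencil: "det (unit_pencil m) = monom 1 m"
proof -
  let ?N = "mat m m (\<lambda>(i, j). if j = i then [:0, 1:] else if j = Suc i then 1 else (0 :: 'a poly))"
  let ?U = "mat m m (\<lambda>(i, j). if i = j then 1 else if j = 0 then - 1 else (0 :: 'a poly))"
  have "det ?N = prod_list (diag_mat ?N)"
    by (rule det_upper_triangular[of _ m]) auto
  also have "\<dots> = (\<Prod>i = 0..<m. [:0, 1:])"
    unfolding prod_list_diag_prod by (intro prod.cong) auto
  finally have "det ?N = [:0, 1:] ^ m" by simp
  moreover have "det ?U = prod_list (diag_mat ?U)"
    by (rule det_lower_triangular[of m]) auto
  moreover have "prod_list (diag_mat ?U) = (\<Prod>i = 0..<m. 1)"
    unfolding prod_list_diag_prod by (intro prod.cong) auto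
  ultimately show ?thesis
    unfolding unit_pencil_def by (subst det_mult[of _ m]) (auto simp: monom_altdef)
qed

lemma comm_ring_hom_poly_eval: "comm_ring_hom (\<lambda>p :: 'a :: comm_ring_1 poly. poly p a)"
  by unfold_locales auto

lemma map_mat_mat_delete: "map_mat f (mat_delete A i j) = mat_delete (map_mat f A) i j"
  by (rule eq_matI) (auto simp: mat_delete_def)

text \<open>
  Evaluate at \<open>x = 0\<close>. The cofactors of the last row are annihilated by all other rows, and
  these rows are \<open>e\<^sub>i\<^sub>+\<^sub>1 - e\<^sub>0\<close>, so that all these cofactors agree. The first of them comes from
  deleting the first column, which leaves the identity matrix.
\<close>
lemma cofactor_unit_pencil:
  assumes "j \<le> n"
  shows "coeff (cofactor (unit_pencil (n + 1)) n j) 0 = (- 1) ^ n"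
proof -
  interpret ev: comm_ring_hom "\<lambda>p :: 'a poly. poly p 0" by (rule comm_ring_hom_poly_eval)
  define S :: "'a mat" where "S = map_mat (\<lambda>p. poly p 0) (unit_pencil (n + 1))"
  have S: "S \<in> carrier_mat (n + 1) (n + 1)" by (simp add: S_def unit_pencil_carrier)
  have S_index: "S $$ (i, l) = (if Suc i = l then 1 else if l = 0 then - 1 else 0)"
    if "i < n" "l \<le> n" for i l
    using that unit_pencil_carrier[of "n + 1", where 'a = 'a]
    by (auto simp: S_def unit_pencil_index)
  have S_cof: "coeff (cofactor (unit_pencil (n + 1)) n l) 0 = cofactor S n l" for l
    by (simp add: cofactor_def S_def flip: poly_0_coeff_0 map_mat_mat_delete)
  have const: "cofactor S n (Suc i) = cofactor S n 0" if "i < n" for i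
  proof -
    have "(S * adj_mat S) $$ (i, n) = 0"
      using that S by (simp add: adj_mat(2)[OF S])
    moreover have "(S * adj_mat S) $$ (i, n) = (\<Sum>l = 0..<n + 1. S $$ (i, l) * cofactor S n l)"
      using that S by (auto simp: scalar_prod_def adj_mat_def intro!: sum.cong)
    moreover have "\<dots> = (\<Sum>l \<in> {0, Suc i}. S $$ (i, l) * cofactor S n l)"
      using that by (intro sum.mono_neutral_right) (auto simp: S_index)
    ultimately show ?thesis using that by (simp add: S_index)
  qed
  have "mat_delete S n 0 = 1\<^sub>m n"
    using S by (intro eq_matI) (auto simp: mat_delete_def S_index)
  then have "cofactor S n 0 = (- 1) ^ n" by (simp add: cofactor_def)
  then show ?thesis
    unfolding S_cof using const[of "j - 1"] assms by (cases j) auto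
qed

section \<open>Minors with prescribed lists of rows and columns\<close>

text \<open>
  Lists of indices, in contrast to sets, allow for arbitrary orders and repetitions of columns.
\<close>
definition rc_mat :: "'a mat \<Rightarrow> nat list \<Rightarrow> nat list \<Rightarrow> 'a mat" where
  "rc_mat A rs cs = mat (length rs) (length cs) (\<lambda>(p, q). A $$ (rs ! p, cs ! q))"

lemma rc_mat_carrier [simp]: "rc_mat A rs cs \<in> carrier_mat (length rs) (length cs)"
  by (simp add: rc_mat_def)

lemma rc_mat_index [simp]:
  "p < length rs \<Longrightarrow> q < length cs \<Longrightarrow> rc_mat A rs cs $$ (p, q) = A $$ (rs ! p, cs ! q)"
  "dim_row (rc_mat A rs cs) = length rs" "dim_col (rc_mat A rs cs) = length cs"
  by (simp_all add: rc_mat_def)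

text \<open>
  Expanding both determinants along the column \<open>x\<close> produces the same minors, and only the
  signs differ.
\<close>
lemma det_move_column_last:
  fixes A :: "'a :: comm_ring_1 mat"
  assumes "length rs = length ys + length zs + 1"
  shows "det (rc_mat A rs (ys @ x # zs))
    = (- 1) ^ (length zs) * det (rc_mat A rs (ys @ zs @ [x]))"
proof -
  let ?m = "length rs"
  let ?X = "rc_mat A rs (ys @ x # zs)" and ?Y = "rc_mat A rs (ys @ zs @ [x])"
  let ?q = "length ys" and ?l = "length ys + length zs"
  have "length (ys @ x # zs) = ?m" "length (ys @ zs @ [x]) = ?m" using assms by simp_all
  then have X: "?X \<in> carrier_mat ?m ?m" and Y: "?Y \<in> carrier_mat ?m ?m"
    using rc_mat_carrier[of A rs "ys @ x # zs"] rc_mat_carrier[of A rs "ys @ zs @ [x]"]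
    by (simp_all only:)
  have del: "mat_delete ?X i ?q = mat_delete ?Y i ?l" if "i < ?m" for i
  proof -
    have "(ys @ x # zs) ! (if j < ?q then j else Suc j) = (ys @ zs @ [x]) ! j" if "j < ?l" for j
    proof (cases "j < ?q")
      case False
      then obtain d where "j = ?q + d" using le_iff_add not_less by metis
      then show ?thesis using that by (simp add: nth_append)
    qed (simp add: nth_append)
    then show ?thesis
      using assms that
      by (intro eq_matI) (simp_all add: mat_delete_def)
  qed
  have sign: "(- 1) ^ (i + ?q) = (- 1) ^ length zs * ((- 1) ^ (i + ?l) :: 'a)" for i
  proof -
    have "(- 1) ^ (i + ?l) = (- 1) ^ length zs * ((- 1) ^ (i + ?q) :: 'a)"
      by (simp only: power_add ac_simps)
    moreover have "(- 1) ^ length zs * (- 1) ^ length zs = (1 :: 'a)"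
      by (simp flip: power_mult_distrib)
    ultimately show ?thesis by (simp flip: mult.assoc)
  qed
  have summand: "?X $$ (i, ?q) * cofactor ?X i ?q = (- 1) ^ length zs * (?Y $$ (i, ?l) * cofactor ?Y i ?l)"
    if i: "i < ?m" for i
  proof -
    have "?X $$ (i, ?q) = ?Y $$ (i, ?l)" using assms i by (simp add: nth_append)
    moreover have "cofactor ?X i ?q = (- 1) ^ length zs * cofactor ?Y i ?l"
      unfolding cofactor_def del[OF i] sign by (simp only: mult.assoc)
    ultimately show ?thesis by (simp only: mult.left_commute)
  qed
  have "(\<Sum>i<?m. ?X $$ (i, ?q) * cofactor ?X i ?q)
      = (- 1) ^ length zs * (\<Sum>i<?m. ?Y $$ (i, ?l) * cofactor ?Y i ?l)"
    unfolding sum_distrib_left by (rule sum.cong[OF refl summand]) simp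
  moreover have "?q < ?m" "?l < ?m" using assms by simp_all
  ultimately show ?thesis
    by (simp only: laplace_expansion_column[OF X, of ?q] laplace_expansion_column[OF Y, of ?l])
qed

lemma map_pick_eq_sorted_list:
  assumes "finite S"
  shows "map (pick S) [0..<card S] = sorted_list_of_set S"
proof (rule strict_sorted_equal)
  show "sorted_wrt (<) (map (pick S) [0..<card S])"
    by (auto simp: sorted_wrt_iff_nth_less intro: pick_mono_le)
  then have "distinct (map (pick S) [0..<card S])" by (simp add: strict_sorted_iff)
  then have "card (set (map (pick S) [0..<card S])) = card S" by (metis distinct_card length_map length_upt diff_zero)
  moreover have "set (map (pick S) [0..<card S]) \<subseteq> S" by (auto intro: pick_in_set_le)
  ultimately show "set (map (pick S) [0..<card S]) = set (sorted_list_of_set S)"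
    using assms by (simp add: card_subset_eq)
qed (use assms in simp)

lemma submatrix_plus_last:
  assumes A: "A \<in> carrier_mat (n + 1) (n + 1)" and I: "I \<subseteq> {..<n}" and J: "J \<subseteq> {..<n}"
  shows "submatrix A (plus_last n I) (plus_last n J)
    = rc_mat A (sorted_list_of_set I @ [n]) (sorted_list_of_set J @ [n])"
proof -
  have fin: "finite K" "finite (plus_last n K)" if "K \<subseteq> {..<n}" for K
    using that finite_subset[of K "{..<n}"] by (auto simp: plus_last_def)
  have sorted: "sorted_list_of_set (plus_last n K) = sorted_list_of_set K @ [n]"
    if K: "K \<subseteq> {..<n}" for K
  proof (rule strict_sorted_equal)
    show "sorted_wrt (<) (sorted_list_of_set (plus_last n K))" by simp
    show "sorted_wrt (<) (sorted_list_of_set K @ [n])"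
      using K fin(1)[OF K] by (auto simp: sorted_wrt_append)
    show "set (sorted_list_of_set (plus_last n K)) = set (sorted_list_of_set K @ [n])"
      using fin[OF K] by (simp add: plus_last_def del: sorted_list_of_set_insert_remove)
  qed
  have card_eq: "{i. i < Suc n \<and> i \<in> plus_last n K} = plus_last n K" if "K \<subseteq> {..<n}" for K
    using that by (auto simp: plus_last_def)
  have "rc_mat A (sorted_list_of_set (plus_last n I)) (sorted_list_of_set (plus_last n J))
      = submatrix A (plus_last n I) (plus_last n J)"
    using A I J fin unfolding submatrix_def rc_mat_def
    by (auto intro!: cong_mat simp: card_eq simp flip: map_pick_eq_sorted_list)
  then show ?thesis by (simp add: sorted I J)
qed

text \<open>
  Expand the minor of \<open>B\<close> along its last row. The sign of the summand for column \<open>j\<close> equals the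
  sign that arises when column \<open>j\<close> of the minor of \<open>A\<close> is moved to the end, so that the product
  has an expansion without signs.
\<close>
lemma det_mult_det_expand:
  fixes A B :: "'a :: comm_ring_1 mat"
  assumes xs: "distinct xs" "length xs = length rs + 1"
  shows "det (rc_mat A (rs @ [r]) xs) * det (rc_mat B (rs @ [r]) xs)
    = (\<Sum>j\<in>set xs. B $$ (r, j) * (det (rc_mat B rs (remove1 j xs))
        * det (rc_mat A (rs @ [r]) (remove1 j xs @ [j]))))"
proof -
  let ?k = "length rs"
  let ?A = "rc_mat A (rs @ [r]) xs" and ?B = "rc_mat B (rs @ [r]) xs"
  have B: "?B \<in> carrier_mat (?k + 1) (?k + 1)"
    using rc_mat_carrier[of B "rs @ [r]" xs] xs by simp
  have summand: "det ?A * (?B $$ (?k, q) * cofactor ?B ?k q)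
      = B $$ (r, xs ! q) * (det (rc_mat B rs (remove1 (xs ! q) xs))
        * det (rc_mat A (rs @ [r]) (remove1 (xs ! q) xs @ [xs ! q])))" if q: "q < ?k + 1" for q
  proof -
    define ys zs where "ys = take q xs" and "zs = drop (Suc q) xs"
    have split: "xs = ys @ xs ! q # zs" and len: "length ys = q" "length zs = ?k - q"
      using q xs by (auto simp: ys_def zs_def id_take_nth_drop)
    then have "xs ! q \<notin> set ys" using xs(1) by (metis distinct_append disjoint_iff list.set_intros(1))
    then have rem: "remove1 (xs ! q) xs = ys @ zs"
      by (subst (2) split) (simp add: remove1_append)
    have "mat_delete ?B ?k q = rc_mat B rs (ys @ zs)"
      using q xs by (intro eq_matI) (auto simp: mat_delete_def nth_append ys_def zs_def)
    moreover have "det ?A = (- 1) ^ (?k - q) * det (rc_mat A (rs @ [r]) (ys @ zs @ [xs ! q]))"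
      using det_move_column_last[of "rs @ [r]" ys zs A "xs ! q"] split len q by simp
    ultimately have "det ?A * (?B $$ (?k, q) * cofactor ?B ?k q)
        = ((- 1) ^ (?k - q) * det (rc_mat A (rs @ [r]) (ys @ zs @ [xs ! q])))
          * (B $$ (r, xs ! q) * ((- 1) ^ (?k + q) * det (rc_mat B rs (ys @ zs))))"
      using q xs by (simp add: cofactor_def nth_append)
    also have "\<dots> = ((- 1) ^ (?k - q) * (- 1) ^ (?k + q)) * (B $$ (r, xs ! q)
          * (det (rc_mat B rs (ys @ zs)) * det (rc_mat A (rs @ [r]) (ys @ zs @ [xs ! q]))))"
      by (simp only: ac_simps)
    also have "(- 1) ^ (?k - q) * (- 1) ^ (?k + q) = (1 :: 'a)"
    proof -
      have "?k - q + (?k + q) = 2 * ?k" using q by simp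
      then show ?thesis by (simp flip: power_add)
    qed
    finally show ?thesis by (simp add: rem)
  qed
  have "det ?B = (\<Sum>q<?k + 1. ?B $$ (?k, q) * cofactor ?B ?k q)"
    by (rule laplace_expansion_row[OF B]) simp
  then have "det ?A * det ?B = (\<Sum>q<?k + 1. det ?A * (?B $$ (?k, q) * cofactor ?B ?k q))"
    by (simp only: sum_distrib_left)
  also have "\<dots> = (\<Sum>q<?k + 1. B $$ (r, xs ! q) * (det (rc_mat B rs (remove1 (xs ! q) xs))
        * det (rc_mat A (rs @ [r]) (remove1 (xs ! q) xs @ [xs ! q]))))"
    by (intro sum.cong refl summand) simp
  also have "\<dots> = (\<Sum>j\<in>set xs. B $$ (r, j) * (det (rc_mat B rs (remove1 j xs))
        * det (rc_mat A (rs @ [r]) (remove1 j xs @ [j]))))"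
    by (rule sum.reindex_bij_betw[OF bij_betw_nth]) (use xs in \<open>auto simp: lessThan_atLeast0\<close>)
  finally show ?thesis .
qed

text \<open>
  By linearity in the last column, the sum is a determinant with last column \<open>A v\<close>, and this
  column vanishes except in its last entry \<open>a\<close>.
\<close>
lemma sum_det_last_column:
  fixes A :: "'a :: comm_ring_1 mat"
  assumes ys: "length ys = length rs" and r: "r \<notin> set rs"
    and v: "\<And>i. i \<in> set (rs @ [r]) \<Longrightarrow> (\<Sum>j\<in>S. v j * A $$ (i, j)) = (if i = r then a else 0)"
  shows "(\<Sum>j\<in>S. v j * det (rc_mat A (rs @ [r]) (ys @ [j]))) = a * det (rc_mat A rs ys)"
proof -
  let ?k = "length rs"
  let ?A = "\<lambda>j. rc_mat A (rs @ [r]) (ys @ [j])"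
  define C where "C i = cofactor (?A r) i ?k" for i
  have cof: "cofactor (?A j) i ?k = C i" if "i < ?k + 1" for i j
  proof -
    have "mat_delete (?A j) i ?k = mat_delete (?A r) i ?k"
      using ys that by (intro eq_matI) (auto simp: mat_delete_def nth_append)
    then show ?thesis by (simp add: C_def cofactor_def)
  qed
  have expand: "det (?A j) = (\<Sum>i<?k + 1. A $$ ((rs @ [r]) ! i, j) * C i)" for j
  proof -
    have "?A j \<in> carrier_mat (?k + 1) (?k + 1)"
      using ys rc_mat_carrier[of A "rs @ [r]" "ys @ [j]"] by simp
    then have "det (?A j) = (\<Sum>i<?k + 1. ?A j $$ (i, ?k) * cofactor (?A j) i ?k)"
      by (rule laplace_expansion_column) simp
    also have "\<dots> = (\<Sum>i<?k + 1. A $$ ((rs @ [r]) ! i, j) * C i)"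
      by (intro sum.cong arg_cong2[where f = "(*)"] cof) (use ys in \<open>auto simp: nth_append\<close>)
    finally show ?thesis .
  qed
  have "(\<Sum>j\<in>S. v j * det (?A j))
      = (\<Sum>j\<in>S. \<Sum>i<?k + 1. v j * A $$ ((rs @ [r]) ! i, j) * C i)"
    by (simp only: expand sum_distrib_left mult.assoc)
  also have "\<dots> = (\<Sum>i<?k + 1. (\<Sum>j\<in>S. v j * A $$ ((rs @ [r]) ! i, j)) * C i)"
    by (simp only: sum_distrib_right) (rule sum.swap)
  also have "\<dots> = (\<Sum>i\<in>{?k}. a * C i)"
  proof (rule sum.mono_neutral_cong_right)
    show "\<forall>i\<in>{..<?k + 1} - {?k}. (\<Sum>j\<in>S. v j * A $$ ((rs @ [r]) ! i, j)) * C i = 0"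
    proof
      fix i assume "i \<in> {..<?k + 1} - {?k}"
      then have "(rs @ [r]) ! i \<in> set rs" by (auto simp: nth_append)
      then show "(\<Sum>j\<in>S. v j * A $$ ((rs @ [r]) ! i, j)) * C i = 0"
        using r by (subst v) auto
    qed
  qed (use v in auto)
  also have "\<dots> = a * det (rc_mat A rs ys)"
  proof -
    have "mat_delete (?A r) ?k ?k = rc_mat A rs ys"
      using ys by (intro eq_matI) (auto simp: mat_delete_def nth_append)
    then show ?thesis by (simp add: C_def cofactor_def flip: mult_2)
  qed
  finally show ?thesis .
qed

text \<open>
  Multiply \<open>M u\<close> by the adjugate of \<open>M\<close>.
\<close>
lemma dvd_det_mult_if_dvd_mult_vec:
  fixes M :: "'a :: comm_ring_1 mat"
  assumes M: "M \<in> carrier_mat N N"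
    and u: "\<And>p. p < N \<Longrightarrow> a dvd (\<Sum>q<N. M $$ (p, q) * u q)" and "q < N"
  shows "a dvd det M * u q"
proof -
  let ?C = "adj_mat M"
  have "(\<Sum>p<N. ?C $$ (q, p) * M $$ (p, s)) = (if q = s then det M else 0)" if "s < N" for s
  proof -
    have "(?C * M) $$ (q, s) = (\<Sum>p<N. ?C $$ (q, p) * M $$ (p, s))"
      using that \<open>q < N\<close> M adj_mat(1)[OF M]
      by (auto simp: scalar_prod_def lessThan_atLeast0 intro!: sum.cong)
    from this[symmetric] show ?thesis using that \<open>q < N\<close> by (simp add: adj_mat(3)[OF M])
  qed
  then have "det M * u q = (\<Sum>s<N. (\<Sum>p<N. ?C $$ (q, p) * M $$ (p, s)) * u s)"
    using \<open>q < N\<close> by (simp add: if_distrib[of "\<lambda>x. x * _"] cong: if_cong)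
  also have "\<dots> = (\<Sum>p<N. ?C $$ (q, p) * (\<Sum>s<N. M $$ (p, s) * u s))"
    by (simp only: sum_distrib_left sum_distrib_right mult.assoc) (rule sum.swap)
  also have "a dvd \<dots>" by (rule dvd_sum) (auto intro: dvd_mult u)
  finally show ?thesis .
qed

section \<open>A kernel vector modulo the determinant\<close>

lemma det_rc_mat_repeated_column:
  fixes A :: "'a :: comm_ring_1 mat"
  assumes "length cs = length rs" "\<not> distinct cs"
  shows "det (rc_mat A rs cs) = 0"
proof -
  obtain p q where pq: "p < length cs" "q < length cs" "p \<noteq> q" "cs ! p = cs ! q"
    using assms(2) by (auto simp: distinct_conv_nth)
  have "rc_mat A rs cs \<in> carrier_mat (length rs) (length rs)"
    using rc_mat_carrier[of A rs cs] assms(1) by simp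
  then show ?thesis
    by (rule det_identical_columns[OF _ pq(3)]) (use pq assms(1) in \<open>auto intro: eq_vecI\<close>)
qed

definition minor_products :: "nat \<Rightarrow> 'a :: comm_ring_1 mat \<Rightarrow> 'a mat \<Rightarrow> nat set \<Rightarrow> nat set \<Rightarrow> 'a" where
  "minor_products n A B I J =
     det (submatrix A (plus_last n I) (plus_last n J)) * det (submatrix B (plus_last n I) (plus_last n J))"

lemma finite_ksubsets: "finite (ksubsets n k)" "J \<in> ksubsets n k \<Longrightarrow> finite J"
  by (rule finite_subset[of _ "Pow {..<n}"]) (auto simp: ksubsets_def intro: finite_subset[of _ "{..<n}"])

text \<open>
  The sum over \<open>J\<close>, after expansion of the minors of \<open>B\<close> along the last row, runs over pairs
  \<open>(J, j)\<close> with \<open>j \<in> J\<close>. In terms of \<open>Z = J - {j}\<close> the weight of a pair is \<open>v\<^sub>j\<close> times a factor that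
  depends on \<open>Z\<close> only, so the sum over \<open>j\<close> is a determinant with last column \<open>A v\<close>.
\<close>
lemma det_dvd_weighted_row_sum:
  fixes A B :: "'a :: comm_ring_1 mat"
  assumes A: "A \<in> carrier_mat (n + 1) (n + 1)" and B: "B \<in> carrier_mat (n + 1) (n + 1)"
    and corner: "B $$ (n, n) = 0"
    and v: "\<And>i. i \<le> n \<Longrightarrow> (\<Sum>j\<le>n. v j * A $$ (i, j)) = (if i = n then det A else 0)"
    and I: "I \<in> ksubsets n k"
  shows "det A dvd (\<Sum>J\<in>ksubsets n k. minor_products n A B I J *
    ((\<Prod>j\<in>J. v j) * (\<Prod>j\<in>{..<n} - J. B $$ (n, j))))"
proof -
  define rs where "rs = sorted_list_of_set I"
  have finI: "finite I" by (rule finite_ksubsets(2)[OF I])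
  have rs: "length rs = k" "set rs \<subseteq> {..<n}"
    using I finI by (auto simp: rs_def ksubsets_def)
  have I': "I \<subseteq> {..<n}" using I by (simp add: ksubsets_def)
  define w where "w J = (\<Prod>j\<in>J. v j) * (\<Prod>j\<in>{..<n} - J. B $$ (n, j))" for J
  define bZ where "bZ Z = det (rc_mat B rs (sorted_list_of_set Z @ [n]))" for Z
  define aZ where "aZ Z j = det (rc_mat A (rs @ [n]) ((sorted_list_of_set Z @ [n]) @ [j]))" for Z j
  \<comment> \<open>For \<open>k = 0\<close> this is empty, in accordance with \<open>W\<^sub>\<emptyset>\<^sub>\<emptyset> = A\<^sub>n\<^sub>n B\<^sub>n\<^sub>n = 0\<close>.\<close>
  define ZS where "ZS = {Z. Z \<subseteq> {..<n} \<and> card Z + 1 = k}"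
  have fin_ZS: "finite ZS" "\<And>Z. Z \<in> ZS \<Longrightarrow> finite Z"
    by (rule finite_subset[of _ "Pow {..<n}"]) (auto simp: ZS_def intro: finite_subset[of _ "{..<n}"])
  have fin: "finite K" if "K \<subseteq> {..<n}" for K :: "nat set"
    by (rule finite_subset[OF that]) simp
  have row: "minor_products n A B I J * w J = (\<Sum>j\<in>J. w (J - {j}) * bZ (J - {j}) * (v j * aZ (J - {j}) j))"
    if J: "J \<in> ksubsets n k" for J
  proof -
    have J': "finite J" "J \<subseteq> {..<n}" "card J = k" "n \<notin> J"
      using J finite_ksubsets(2)[OF J] by (auto simp: ksubsets_def)
    let ?xs = "sorted_list_of_set J @ [n]"
    have "minor_products n A B I J = det (rc_mat A (rs @ [n]) ?xs) * det (rc_mat B (rs @ [n]) ?xs)"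
      by (simp only: minor_products_def rs_def submatrix_plus_last[OF A I' J'(2)] submatrix_plus_last[OF B I' J'(2)])
    also have "\<dots> = (\<Sum>j\<in>set ?xs. B $$ (n, j) * (det (rc_mat B rs (remove1 j ?xs))
        * det (rc_mat A (rs @ [n]) (remove1 j ?xs @ [j]))))"
      by (rule det_mult_det_expand) (use J' rs in auto)
    also have "\<dots> = (\<Sum>j\<in>J. B $$ (n, j) * (bZ (J - {j}) * aZ (J - {j}) j))"
      using J' by (intro sum.mono_neutral_cong_right)
        (auto simp: corner bZ_def aZ_def remove1_append sorted_list_of_set.sorted_key_list_of_set_remove)
    finally have "minor_products n A B I J * w J
        = (\<Sum>j\<in>J. w J * B $$ (n, j) * (bZ (J - {j}) * aZ (J - {j}) j))"
      by (simp add: sum_distrib_left sum_distrib_right ac_simps)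
    also have "\<dots> = (\<Sum>j\<in>J. w (J - {j}) * bZ (J - {j}) * (v j * aZ (J - {j}) j))"
    proof (rule sum.cong[OF refl])
      fix j assume j: "j \<in> J"
      have "(\<Prod>i\<in>J. v i) = v j * (\<Prod>i\<in>J - {j}. v i)"
        using j J' by (simp add: prod.remove)
      moreover have "{..<n} - (J - {j}) = insert j ({..<n} - J)" using j J' by auto
      then have "(\<Prod>i\<in>{..<n} - (J - {j}). B $$ (n, i)) = B $$ (n, j) * (\<Prod>i\<in>{..<n} - J. B $$ (n, i))"
        using j by simp
      ultimately show "w J * B $$ (n, j) * (bZ (J - {j}) * aZ (J - {j}) j)
          = w (J - {j}) * bZ (J - {j}) * (v j * aZ (J - {j}) j)"
        by (simp add: w_def ac_simps)
    qed
    finally show ?thesis .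
  qed
  have inner: "(\<Sum>j\<in>{..<n} - Z. v j * aZ Z j) = det A * det (rc_mat A rs (sorted_list_of_set Z @ [n]))"
    if Z: "Z \<in> ZS" for Z
  proof -
    have len: "length (sorted_list_of_set Z @ [n]) = length rs"
      using Z fin_ZS(2)[OF Z] rs by (auto simp: ZS_def)
    \<comment> \<open>The sum may be extended to all columns of \<open>A\<close>, as the new summands have a repeated column.\<close>
    have "aZ Z j = 0" if "j \<in> insert n Z" for j
      unfolding aZ_def using that len fin_ZS(2)[OF Z] by (intro det_rc_mat_repeated_column) auto
    then have "(\<Sum>j\<in>{..<n} - Z. v j * aZ Z j) = (\<Sum>j\<in>{..n}. v j * aZ Z j)"
      by (intro sum.mono_neutral_left) (auto simp: le_less)
    also have "\<dots> = det A * det (rc_mat A rs (sorted_list_of_set Z @ [n]))"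
      unfolding aZ_def
    proof (rule sum_det_last_column[OF len])
      show "n \<notin> set rs" using rs by auto
      show "(\<Sum>j\<le>n. v j * A $$ (i, j)) = (if i = n then det A else 0)" if "i \<in> set (rs @ [n])" for i
        by (rule v) (use that rs in auto)
    qed
    finally show ?thesis .
  qed
  have "(\<Sum>J\<in>ksubsets n k. minor_products n A B I J * w J)
      = (\<Sum>J\<in>ksubsets n k. \<Sum>j\<in>J. w (J - {j}) * bZ (J - {j}) * (v j * aZ (J - {j}) j))"
    by (rule sum.cong[OF refl row])
  also have "\<dots> = (\<Sum>(J, j)\<in>Sigma (ksubsets n k) (\<lambda>J. J). w (J - {j}) * bZ (J - {j}) * (v j * aZ (J - {j}) j))"
    by (intro sum.Sigma) (auto simp: finite_ksubsets)
  also have "\<dots> = (\<Sum>(Z, j)\<in>Sigma ZS (\<lambda>Z. {..<n} - Z). w Z * bZ Z * (v j * aZ Z j))"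
    by (rule sum.reindex_bij_witness[of _ "\<lambda>(Z, j). (insert j Z, j)" "\<lambda>(J, j). (J - {j}, j)"])
      (auto simp: ksubsets_def ZS_def insert_absorb fin card_Suc_Diff1 simp del: card_Diff_insert)
  also have "\<dots> = (\<Sum>Z\<in>ZS. \<Sum>j\<in>{..<n} - Z. w Z * bZ Z * (v j * aZ Z j))"
    by (intro sum.Sigma[symmetric]) (auto simp: fin_ZS)
  also have "\<dots> = (\<Sum>Z\<in>ZS. w Z * bZ Z * (det A * det (rc_mat A rs (sorted_list_of_set Z @ [n]))))"
    by (intro sum.cong refl) (simp add: inner flip: sum_distrib_left)
  also have "det A dvd \<dots>" by (intro dvd_sum dvd_mult dvd_triv_left)
  finally show ?thesis by (simp add: w_def)
qed

lemma cofactor_last_row_sum: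
  assumes A: "A \<in> carrier_mat (n + 1) (n + 1)" and "i \<le> n"
  shows "(\<Sum>j\<le>n. cofactor A n j * A $$ (i, j)) = (if i = n then det A else (0 :: 'a :: comm_ring_1))"
proof -
  have "(A * adj_mat A) $$ (i, n) = (\<Sum>j\<le>n. cofactor A n j * A $$ (i, j))"
    using assms by (auto simp: scalar_prod_def adj_mat_def ac_simps atLeast0AtMost
        atLeastLessThanSuc_atLeastAtMost intro!: sum.cong)
  from this[symmetric] show ?thesis using \<open>i \<le> n\<close> by (simp add: adj_mat(2)[OF A])
qed

lemma det_dvd_det_minor_products_weighted:
  fixes A B :: "'a :: comm_ring_1 mat"
  assumes A: "A \<in> carrier_mat (n + 1) (n + 1)" and B: "B \<in> carrier_mat (n + 1) (n + 1)"
    and corner: "B $$ (n, n) = 0" and xs: "distinct xs" "set xs = ksubsets n k"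
    and J: "J \<in> ksubsets n k"
  shows "det A dvd ((\<Prod>j\<in>J. cofactor A n j) * (\<Prod>j\<in>{..<n} - J. B $$ (n, j)))
    * det (mat_of_enum xs (minor_products n A B))"
proof -
  define w where "w J = (\<Prod>j\<in>J. cofactor A n j) * (\<Prod>j\<in>{..<n} - J. B $$ (n, j))" for J
  let ?M = "mat_of_enum xs (minor_products n A B)"
  obtain q where q: "q < length xs" "xs ! q = J" using J xs(2) by (metis in_set_conv_nth)
  have "det A dvd det ?M * w (xs ! q)"
  proof (rule dvd_det_mult_if_dvd_mult_vec[OF _ _ q(1)])
    fix p assume p: "p < length xs"
    have "(\<Sum>q<length xs. ?M $$ (p, q) * w (xs ! q))
        = (\<Sum>q<length xs. minor_products n A B (xs ! p) (xs ! q) * w (xs ! q))"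
      using p by (intro sum.cong) (auto simp: mat_of_enum_def)
    also have "\<dots> = (\<Sum>J\<in>ksubsets n k. minor_products n A B (xs ! p) J * w J)"
      by (rule sum.reindex_bij_betw[OF bij_betw_nth]) (use xs in \<open>auto simp: lessThan_atLeast0\<close>)
    also have "det A dvd \<dots>"
      unfolding w_def using p xs(2) nth_mem[OF p]
      by (intro det_dvd_weighted_row_sum[OF A B corner] cofactor_last_row_sum[OF A]) auto
    finally show "det A dvd (\<Sum>q<length xs. ?M $$ (p, q) * w (xs ! q))" .
  qed (simp add: mat_of_enum_def)
  then show ?thesis by (simp add: q(2) w_def mult.commute)
qed

section \<open>Cancelling the kernel vector for perturbed matrices\<close>

lemma mat_delete_index_carrier:
  assumes "A \<in> carrier_mat (n + 1) (n + 1)" "i < n" "j < n"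
  shows "mat_delete A p q $$ (i, j) = A $$ (insert_index p i, insert_index q j)"
  using assms by (auto simp: mat_delete_def insert_index_def)

lemma coprime_lead_cofactor:
  fixes P :: "'a :: comm_ring_1 poly poly mat"
  assumes P: "P \<in> carrier_mat (n + 1) (n + 1)"
    and deg: "\<And>i j. i \<le> n \<Longrightarrow> j \<le> n \<Longrightarrow> degree (P $$ (i, j)) \<le> 1"
    and top: "map_mat (\<lambda>p. coeff p 1) P = unit_pencil (n + 1)" and "j \<le> n"
  shows "coprime_lead (cofactor P n j)"
proof -
  have D: "mat_delete P n j \<in> carrier_mat n n" using mat_delete_carrier[OF P, of n j] by simp
  have D_deg: "degree (mat_delete P n j $$ (i, l)) \<le> 1" if "i < n" "l < n" for i l
    unfolding mat_delete_index_carrier[OF P that] by (rule deg) (use that in \<open>auto simp: insert_index_def\<close>)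
  have "map_mat (\<lambda>p. coeff p 1) (mat_delete P n j) = mat_delete (unit_pencil (n + 1)) n j"
    by (simp only: map_mat_mat_delete top)
  then have "coeff (det (mat_delete P n j)) n = det (mat_delete (unit_pencil (n + 1)) n j)"
    using det_pencil_top(2)[OF D D_deg] by simp
  then have "coeff (cofactor P n j) n = cofactor (unit_pencil (n + 1)) n j"
    by (simp add: cofactor_def minus_one_power_iff)
  then have "coeff (coeff (cofactor P n j) n) 0 = (- 1) ^ n"
    using cofactor_unit_pencil[OF \<open>j \<le> n\<close>, where 'a = 'a] by simp
  then have "coeff (coeff (cofactor P n j) n) 0 dvd 1"
    by (simp add: minus_one_power_iff)
  moreover have "degree (cofactor P n j) \<le> n"
    using det_pencil_top(1)[OF D D_deg] by (simp add: cofactor_def minus_one_power_iff)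
  ultimately show ?thesis by (auto simp: coprime_lead_def)
qed

lemma map_mat_submatrix: "map_mat f (submatrix A I J) = submatrix (map_mat f A) I J"
  by (rule eq_matI) (auto simp: submatrix_def pick_le)

lemma (in comm_ring_hom) det_mat_of_enum_minor_products_hom:
  "hom (det (mat_of_enum xs (minor_products n A B)))
    = det (mat_of_enum xs (minor_products n (map_mat hom A) (map_mat hom B)))"
proof -
  have "map_mat hom (mat_of_enum xs (minor_products n A B))
      = mat_of_enum xs (minor_products n (map_mat hom A) (map_mat hom B))"
    by (rule eq_matI)
      (auto simp: mat_of_enum_def minor_products_def hom_mult simp flip: hom_det map_mat_submatrix)
  then show ?thesis by (metis hom_det)
qed

lemma dominated_det_minor_products:
  fixes A B :: "'a :: comm_ring_1 poly poly mat"
  assumes A: "A \<in> carrier_mat (n + 1) (n + 1)" and B: "B \<in> carrier_mat (n + 1) (n + 1)"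
    and domA: "\<And>i j. i \<le> n \<Longrightarrow> j \<le> n \<Longrightarrow> dominated (A $$ (i, j))"
    and domB: "\<And>i j. i \<le> n \<Longrightarrow> j \<le> n \<Longrightarrow> dominated (B $$ (i, j))"
    and xs: "set xs = ksubsets n k"
  shows "dominated (det (mat_of_enum xs (minor_products n A B)))"
proof -
  have dom: "dominated (det (submatrix C (plus_last n I) (plus_last n J)))"
    if C: "C \<in> carrier_mat (n + 1) (n + 1)" "\<And>i j. i \<le> n \<Longrightarrow> j \<le> n \<Longrightarrow> dominated (C $$ (i, j))"
      and "I \<in> ksubsets n k" "J \<in> ksubsets n k" for C :: "'a poly poly mat" and I J
  proof -
    let ?l = "\<lambda>K. sorted_list_of_set K @ [n]"
    have K: "K \<subseteq> {..<n}" "length (?l K) = k + 1" "\<And>p. p < k + 1 \<Longrightarrow> ?l K ! p \<le> n"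
      if "K \<in> ksubsets n k" for K
    proof -
      have fin: "finite K" by (rule finite_ksubsets(2)[OF that])
      then show "K \<subseteq> {..<n}" and len: "length (?l K) = k + 1" using that by (auto simp: ksubsets_def)
      have "set (?l K) \<subseteq> {..n}" using that fin by (auto simp: ksubsets_def)
      then show "?l K ! p \<le> n" if "p < k + 1" for p
        using nth_mem[of p "?l K"] that len by auto
    qed
    have "rc_mat C (?l I) (?l J) \<in> carrier_mat (k + 1) (k + 1)"
      using rc_mat_carrier[of C "?l I" "?l J"] K that(3,4) by simp
    then have "dominated (det (rc_mat C (?l I) (?l J)))"
      by (rule dominated_det) (use that K in \<open>simp del: length_append\<close>)
    then show ?thesis using that K by (simp add: submatrix_plus_last[OF C(1)])
  qed
  have "mat_of_enum xs (minor_products n A B) \<in> carrier_mat (length xs) (length xs)"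
    by (simp add: mat_of_enum_def)
  then show ?thesis
  proof (rule dominated_det)
    fix p q assume pq: "p < length xs" "q < length xs"
    then have "xs ! p \<in> ksubsets n k" "xs ! q \<in> ksubsets n k" using xs nth_mem by auto
    then show "dominated (mat_of_enum xs (minor_products n A B) $$ (p, q))"
      using pq by (auto simp: mat_of_enum_def minor_products_def
          intro!: dominated_mult dom A B domA domB)
  qed
qed

text \<open>
  The perturbed matrices \<open>A'\<close> and \<open>B'\<close> make the weight of \<open>{..<k}\<close> cancellable: its factors are
  last-row cofactors of \<open>A'\<close>, whose leading coefficients are those of the pencil, and entries
  \<open>b\<^sub>j + z\<close>. The corner of \<open>B\<close> stays unperturbed because it has to remain \<open>0\<close>.
\<close>
theorem det_dvd_det_minor_products:
  fixes A B :: "'a :: comm_ring_1 mat"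
  assumes "k \<le> n" and A: "A \<in> carrier_mat (n + 1) (n + 1)" and B: "B \<in> carrier_mat (n + 1) (n + 1)"
    and corner: "B $$ (n, n) = 0" and xs: "distinct xs" "set xs = ksubsets n k"
  shows "det A dvd det (mat_of_enum xs (minor_products n A B))"
proof -
  define A' :: "'a poly poly mat" where
    "A' = mat (n + 1) (n + 1) (\<lambda>(i, j). [:[:A $$ (i, j):], unit_pencil (n + 1) $$ (i, j):])"
  define B' :: "'a poly poly mat" where
    "B' = mat (n + 1) (n + 1) (\<lambda>(i, j). [:[:B $$ (i, j):], if i = n \<and> j < n then 1 else 0:])"
  have A': "A' \<in> carrier_mat (n + 1) (n + 1)" and B': "B' \<in> carrier_mat (n + 1) (n + 1)"
    by (auto simp: A'_def B'_def)
  have A'_deg: "degree (A' $$ (i, j)) \<le> 1" if "i \<le> n" "j \<le> n" for i j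
    using that by (simp add: A'_def)
  have A'_top: "map_mat (\<lambda>p. coeff p 1) A' = unit_pencil (n + 1)"
    using unit_pencil_carrier[of "n + 1", where 'a = 'a] by (intro eq_matI) (auto simp: A'_def)
  have A'_dom: "dominated (A' $$ (i, j))" if "i \<le> n" "j \<le> n" for i j
  proof -
    have "degree (unit_pencil (n + 1) $$ (i, j) :: 'a poly) \<le> 1"
      using that by (auto simp: unit_pencil_index one_pCons)
    from dominated_pencil[OF this, of "A $$ (i, j)"] show ?thesis using that by (simp add: A'_def)
  qed
  have B'_dom: "dominated (B' $$ (i, j))" if "i \<le> n" "j \<le> n" for i j
  proof -
    have "dominated [:[:B $$ (i, j):], if i = n \<and> j < n then 1 else 0:]"
      by (rule dominated_pencil) simp
    then show ?thesis using that by (simp add: B'_def)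
  qed
  let ?J = "{..<k}"
  let ?W = "mat_of_enum xs (minor_products n A' B')"
  have "det A' dvd det ?W"
  proof (rule dvd_cancel_coprime_lead)
    show "degree (det A') \<le> n + 1" "coeff (det A') (n + 1) = monom 1 (n + 1)"
      using det_pencil_top[OF A'] A'_deg by (simp_all add: A'_top det_unit_pencil flip: One_nat_def)
    show "dominated (det A')" by (rule dominated_det[OF A']) (simp add: A'_dom)
    show "dominated (det ?W)"
      by (rule dominated_det_minor_products[OF A' B' A'_dom B'_dom xs(2)])
    let ?g = "(\<Prod>j\<in>?J. cofactor A' n j) * (\<Prod>j\<in>{..<n} - ?J. B' $$ (n, j))"
    have "?J \<in> ksubsets n k" using \<open>k \<le> n\<close> by (auto simp: ksubsets_def)
    moreover have "B' $$ (n, n) = 0" by (simp add: B'_def corner)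
    ultimately show "det A' dvd ?g * det ?W"
      using det_dvd_det_minor_products_weighted[OF A' B' _ xs] by blast
    have "coprime_lead (B' $$ (n, j))" if "j < n" for j
      using that by (auto simp: coprime_lead_def B'_def intro!: exI[of _ 1])
    then show "coprime_lead ?g"
      using \<open>k \<le> n\<close>
      by (intro coprime_lead_mult coprime_lead_prod coprime_lead_cofactor[OF A' A'_deg A'_top]) auto
  qed
  interpret ev: comm_ring_hom "\<lambda>p :: 'a poly poly. poly (poly p 0) 0"
    by unfold_locales auto
  have eval: "map_mat (\<lambda>p. poly (poly p 0) 0) A' = A" "map_mat (\<lambda>p. poly (poly p 0) 0) B' = B"
    using A B by (auto simp: A'_def B'_def intro!: eq_matI)
  have "poly (poly (det ?W) 0) 0 = det (mat_of_enum xs (minor_products n A B))"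
    by (simp only: ev.det_mat_of_enum_minor_products_hom eval)
  moreover have "poly (poly (det A') 0) 0 = det A"
    by (simp only: eval flip: ev.hom_det)
  moreover note ev.hom_dvd[OF \<open>det A' dvd det ?W\<close>]
  ultimately show ?thesis by (simp only:)
qed

section \<open>Divisibility by the product of both determinants\<close>

theorem theorem2p2:
  fixes A B :: "'a :: comm_ring_1 mat"
    and n k :: nat
    and W :: "nat set \<Rightarrow> nat set \<Rightarrow> 'a"
    and xs :: "nat set list"
  assumes "k \<le> n"
    and "A \<in> carrier_mat (n + 1) (n + 1)"
    and "B \<in> carrier_mat (n + 1) (n + 1)"
    and "A $$ (n, n) = 0"
    and "B $$ (n, n) = 0"
    and "\<And>I J. I \<in> ksubsets n k \<Longrightarrow> J \<in> ksubsets n k \<Longrightarrow>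
           W I J = det (submatrix A (plus_last n I) (plus_last n J))
                 * det (submatrix B (plus_last n I) (plus_last n J))"
    and "distinct xs"
    and "set xs = ksubsets n k"
  shows "det A * det B dvd det (mat_of_enum xs W)"
proof -
  note A = assms(2) and B = assms(3) and xs = assms(7,8)
  have W: "mat_of_enum xs W = mat_of_enum xs (minor_products n A B)"
    unfolding mat_of_enum_def
    by (rule cong_mat) (use assms(6) xs(2) nth_mem[of _ xs] in \<open>auto simp: minor_products_def\<close>)
  show ?thesis
  proof (cases "n = 0")
    case True
    then have "det A = 0" using A assms(4) by (simp add: det_single)
    then show ?thesis
      using det_dvd_det_minor_products[OF \<open>k \<le> n\<close> A B assms(5) xs] by (simp add: W)
  next
    case False
    define A' where "A' = map_mat (\<lambda>a. [:a:]) A"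
    \<comment> \<open>The transposition of the indices \<open>0\<close> and \<open>n\<close> has corner \<open>0\<close> because \<open>n \<noteq> 0\<close>.\<close>
    define B' where "B' = mat (n + 1) (n + 1) (\<lambda>(i, j). [:B $$ (i, j), swaprows_mat (n + 1) 0 n $$ (i, j):])"
    have A': "A' \<in> carrier_mat (n + 1) (n + 1)" and B': "B' \<in> carrier_mat (n + 1) (n + 1)"
      using A by (auto simp: A'_def B'_def)
    have corners: "A' $$ (n, n) = 0" "B' $$ (n, n) = 0"
      using A assms(4,5) False by (auto simp: A'_def B'_def)
    interpret const: comm_ring_hom "\<lambda>a :: 'a. [:a:]"
      by unfold_locales (auto simp: one_pCons)
    interpret ev: comm_ring_hom "\<lambda>p :: 'a poly. poly p 0" by (rule comm_ring_hom_poly_eval)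
    have det_A': "det A' = [:det A:]" by (simp add: A'_def)
    let ?W = "mat_of_enum xs (minor_products n A' B')"
    have "minor_products n B' A' = minor_products n A' B'"
      by (intro ext) (simp add: minor_products_def mult.commute)
    then have "det B' dvd det ?W"
      using det_dvd_det_minor_products[OF \<open>k \<le> n\<close> B' A' corners(1) xs] by simp
    then obtain c where c: "det ?W = det B' * c" by (elim dvdE)
    have "[:det A:] dvd c"
    proof (rule const_dvd_cancel_unit_lead)
      have B'_deg: "degree (B' $$ (i, j)) \<le> 1" if "i < n + 1" "j < n + 1" for i j
        using that by (simp add: B'_def)
      show "degree (det B') \<le> n + 1" by (rule det_pencil_top(1)[OF B' B'_deg])
      have "map_mat (\<lambda>p. coeff p 1) B' = swaprows_mat (n + 1) 0 n"
        by (rule eq_matI) (auto simp: B'_def)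
      then have "coeff (det B') (n + 1) = - 1"
        using det_pencil_top(2)[OF B' B'_deg] False by (simp add: det_swaprows_mat flip: One_nat_def)
      then show "coeff (det B') (n + 1) dvd 1" by simp
      show "[:det A:] dvd det B' * c"
        using det_dvd_det_minor_products[OF \<open>k \<le> n\<close> A' B' corners(2) xs] by (simp add: det_A' c)
    qed
    then have "det A' * det B' dvd det ?W"
      unfolding c det_A' by (metis dvd_refl mult.commute mult_dvd_mono)
    then have "poly (det A' * det B') 0 dvd poly (det ?W) 0" by (rule ev.hom_dvd)
    moreover have eval: "map_mat (\<lambda>p. poly p 0) A' = A" "map_mat (\<lambda>p. poly p 0) B' = B"
      using A B by (auto simp: A'_def B'_def intro!: eq_matI)
    moreover have "poly (det ?W) 0 = det (mat_of_enum xs (minor_products n A B))"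
      by (simp only: ev.det_mat_of_enum_minor_products_hom eval)
    moreover have "poly (det A' * det B') 0 = det A * det B"
      by (simp only: ev.hom_mult eval flip: ev.hom_det)
    ultimately show ?thesis by (simp only: W)
  qed
qed

end
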